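(* Fix an integer $n\ge1$. (i) If $A=0$, $B=1$, then as $t\to1^-$, \begin{align*} D_n(t)\sim\;&2^{-2n(n+\beta+\gamma)}(2\pi)^n\frac{\Gamma\left(\frac{\beta+\gamma+1}{2}\right)G^2\left(\frac{\beta+\gamma+1}{2}\right)G^2\left(\frac{\beta+\gamma}{2}+1\right)}{G(\beta+\gamma+1)G(\beta+1)G(\gamma+1)}\\ &\times\frac{G(n+1)G(n+\beta+1)G(n+\gamma+1)G(n+\beta+\gamma+1)}{G^2\left(n+\frac{\beta+\gamma+1}{2}\right)G^2\left(n+\frac{\beta+\gamma}{2}+1\right)\Gamma\left(n+\frac{\beta+\gamma+1}{2}\right)}(1-t)^{n(n+\beta+\gamma)}. \end{align*} (ii) If $A=1$, $B=-1$, then as $t\to0^+$, \begin{align*} D_n(t)\sim\;&2^{-2n(n+\alpha+\gamma)}(2\pi)^n\frac{\Gamma\left(\frac{\alpha+\gamma+1}{2}\right)G^2\left(\frac{\alpha+\gamma+1}{2}\right)G^2\left(\frac{\alpha+\gamma}{2}+1\right)}{G(\alpha+\gamma+1)G(\alpha+1)G(\gamma+1)}\\ &\times\frac{G(n+1)G(n+\alpha+1)G(n+\gamma+1)G(n+\alpha+\gamma+1)}{G^2\left(n+\frac{\alpha+\gamma+1}{2}\right)G^2\left(n+\frac{\alpha+\gamma}{2}+1\right)\Gamma\left(n+\frac{\alpha+\gamma+1}{2}\right)}t^{n(n+\alpha+\gamma)}. \end{align*} Here $f\sim g$ means $f/g\to1$.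
   Context: Fix $\alpha,\beta,\gamma>0$. Let $\theta$ be the Heaviside function ($\theta(x)=1$ for $x>0$, $0$ otherwise). For $t\in(0,1)$ and constants $A,B$, put $w(x,t)=x^{\alpha}(1-x)^{\beta}|x-t|^{\gamma}(A+B\theta(x-t))$ on $[0,1]$ and $D_n(t)=\det\left(\int_0^1x^{i+j}w(x,t)dx\right)_{i,j=0}^{n-1}=\frac1{n!}\int_{[0,1]^n}\prod_{i<j}(x_i-x_j)^2\prod_jw(x_j,t)dx_j$. $G$ denotes the Barnes $G$-function, $G(x+1)=(2\pi)^{x/2}e^{-\frac12x(x+1)-\frac12\gamma_Ex^2}\prod_{k\ge1}\left[(1+\frac xk)^ke^{-x+\frac{x^2}{2k}}\right]$, with $\gamma_E$ the Euler–Mascheroni constant. *)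

theory Defs
  imports "HOL-Analysis.Analysis" "Jordan_Normal_Form.Determinant"
begin

text \<open>Barnes G-function via the Weierstrass product: barnesG (x+1) is given by the
  product formula in x; hence barnesG z uses x = z - 1.\<close>
definition barnesG :: "real \<Rightarrow> real" where
  "barnesG z = (let x = z - 1 in
     (2 * pi) powr (x / 2) * exp (- (1/2) * x * (x + 1) - (1/2) * euler_mascheroni * x^2) *
     prodinf (\<lambda>k. (1 + x / real (Suc k)) ^ (Suc k) * exp (- x + x^2 / (2 * real (Suc k)))))"

definition heaviside :: "real \<Rightarrow> real" where
  "heaviside x = (if x > 0 then 1 else 0)"

definition wfun :: "real \<Rightarrow> real \<Rightarrow> real \<Rightarrow> real \<Rightarrow> real \<Rightarrow> real \<Rightarrow> real \<Rightarrow> real" where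
  "wfun \<alpha> \<beta> \<gamma> A B x t =
     x powr \<alpha> * (1 - x) powr \<beta> * \<bar>x - t\<bar> powr \<gamma> * (A + B * heaviside (x - t))"

definition Dn :: "real \<Rightarrow> real \<Rightarrow> real \<Rightarrow> real \<Rightarrow> real \<Rightarrow> nat \<Rightarrow> real \<Rightarrow> real" where
  "Dn \<alpha> \<beta> \<gamma> A B n t = Determinant.det (Matrix.mat n n (\<lambda>(i, j).
      integral {0..1} (\<lambda>x. x ^ (i + j) * wfun \<alpha> \<beta> \<gamma> A B x t)))"

end

theory Submission
  imports Defs "HOL-Real_Asymp.Real_Asymp"
begin

text \<open>
  The reflection \<open>x \<mapsto> 1 - x\<close> is a unimodular change of the monomial basis up to sign, so part (i) for
  \<open>(\<alpha>, \<beta>, t)\<close> is part (ii) for \<open>(\<beta>, \<alpha>, 1 - t)\<close>. In part (ii) the weight lives on \<open>[0, t]\<close>, and \<open>x = t u\<close>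
  extracts the power \<open>t powr n (n + \<alpha> + \<gamma>)\<close> from the determinant exactly; what remains converges to
  the Hankel determinant of the Jacobi weight \<open>u powr \<alpha> * (1 - u) powr \<gamma>\<close>, because \<open>(1 - t u) powr \<beta>\<close>
  lies between \<open>(1 - t) powr \<beta>\<close> and 1. This determinant is a product of Gamma functions. The recurrence
  \<open>G(x + 1) = \<Gamma>(x) G(x)\<close> and Legendre's duplication formula identify it with the stated constant.
\<close>

subsection \<open>The recurrence of the Barnes G-function\<close>

text \<open>The factor of index \<open>k + 1\<close> in the Weierstrass product. The argument is
  shifted by one: \<open>barnes_factor x\<close> belongs to \<open>barnesG (x + 1)\<close>.\<close>

definition barnes_factor :: "real \<Rightarrow> nat \<Rightarrow> real" where
  "barnes_factor x k = (1 + x / real (Suc k)) ^ Suc k * exp (- x + x\<^sup>2 / (2 * real (Suc k)))"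

text \<open>The exponential removes the first two terms of the expansion of
  \<open>(k + 1) * ln (1 + x / (k + 1))\<close>, so the logarithm of a factor is O(1/k^2). For x >
  -1 every factor is positive, and the product is the exponential of a convergent series.\<close>

lemma barnes_factor_convergent_prod:
  assumes "x > -1"
  shows "convergent_prod (barnes_factor x)" "prodinf (barnes_factor x) > 0"
proof -
  define g where "g k = real (Suc k) * ln (1 + x / real (Suc k)) - x + x\<^sup>2 / (2 * real (Suc k))" for k
  have pos: "1 + x / real (Suc k) > 0" for k
    using assms by (simp add: field_simps)
  have eq: "barnes_factor x = (\<lambda>k. exp (g k))"
  proof
    fix k
    have "exp (g k) = exp (real (Suc k) * ln (1 + x / real (Suc k))) * exp (- x + x\<^sup>2 / (2 * real (Suc k)))"
      by (simp add: g_def exp_add [symmetric])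
    also have "exp (real (Suc k) * ln (1 + x / real (Suc k))) = (1 + x / real (Suc k)) ^ Suc k"
      by (subst exp_of_nat_mult) (simp only: exp_ln pos)
    finally show "barnes_factor x k = exp (g k)" by (simp add: barnes_factor_def)
  qed
  have "g \<in> O(\<lambda>k. 1 / real k ^ 2)"
  proof -
    \<comment> \<open>The leading term x^3 / (3 k^2) of \<open>g\<close> has the sign of x, which
      must be decided before expanding.\<close>
    consider "x = 0" | "x > 0" | "x < 0" by linarith
    then show ?thesis
    proof cases
      case 1
      then show ?thesis by (simp add: g_def [abs_def])
    next
      case 2
      then show ?thesis unfolding g_def [abs_def] power2_eq_square by real_asymp
    next
      case 3
      then show ?thesis unfolding g_def [abs_def] power2_eq_square by real_asymp
    qed
  qed
  then have "summable g"
    by (rule summable_comparison_test_bigo [rotated])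
       (use inverse_power_summable [of 2, where 'a = real] in \<open>simp add: field_simps\<close>)
  then show "convergent_prod (barnes_factor x)" "prodinf (barnes_factor x) > 0"
    unfolding eq by (simp_all add: convergent_prod_exp prodinf_exp)
qed

lemma barnesG_altdef:
  "barnesG (x + 1) = (2 * pi) powr (x / 2) * exp (- (1/2) * x * (x + 1) - (1/2) * euler_mascheroni * x\<^sup>2)
     * prodinf (barnes_factor x)"
  by (simp add: barnesG_def barnes_factor_def [abs_def] Let_def)

lemma barnesG_pos:
  assumes "z > 0"
  shows "barnesG z > 0"
  using barnesG_altdef [of "z - 1"] barnes_factor_convergent_prod(2) [of "z - 1"] assms by simp

text \<open>A single quotient is a power of \<open>(k + 1 + x) / (k + x)\<close> times an
  exponential. The powers telescope, leaving one \<open>real k + x\<close> in the denominator for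
  each k, and the exponents sum to a harmonic number.\<close>

lemma barnes_factor_ratio:
  assumes "x > 0"
  shows "(\<Prod>k<N. barnes_factor x k) / (\<Prod>k<N. barnes_factor (x - 1) k) =
    (real N + x) ^ N / pochhammer x N * exp (- real N + (x - 1/2) * harm N)"
proof -
  have "barnes_factor x k / barnes_factor (x - 1) k =
      ((real (Suc k) + x) / (real k + x)) ^ Suc k * exp (- 1 + (x - 1/2) / real (Suc k))" for k
  proof -
    have "(1 + x / real (Suc k)) / (1 + (x - 1) / real (Suc k)) = (real (Suc k) + x) / (real k + x)"
    proof -
      have "1 + x / real (Suc k) = (real (Suc k) + x) / real (Suc k)"
        "1 + (x - 1) / real (Suc k) = (real k + x) / real (Suc k)"
        by (simp_all add: field_simps)
      then show ?thesis by simp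
    qed
    moreover have "exp (- x + x\<^sup>2 / (2 * real (Suc k))) / exp (- (x - 1) + (x - 1)\<^sup>2 / (2 * real (Suc k)))
        = exp (- 1 + (x - 1/2) / real (Suc k))"
      unfolding exp_diff [symmetric]
    proof (rule arg_cong [of _ _ exp])
      define y where "y = real (Suc k)"
      have "y > 0" by (simp add: y_def)
      then have "- x + x\<^sup>2 / (2 * y) - (- (x - 1) + (x - 1)\<^sup>2 / (2 * y)) = - 1 + (x - 1/2) / y"
        by (simp add: field_simps power2_eq_square)
      then show "- x + x\<^sup>2 / (2 * real (Suc k)) - (- (x - 1) + (x - 1)\<^sup>2 / (2 * real (Suc k))) =
          - 1 + (x - 1/2) / real (Suc k)"
        by (simp only: y_def)
    qed
    ultimately show ?thesis
      unfolding barnes_factor_def times_divide_times_eq [symmetric] power_divide [symmetric]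
      by (simp only:)
  qed
  then have "(\<Prod>k<N. barnes_factor x k) / (\<Prod>k<N. barnes_factor (x - 1) k) =
      (\<Prod>k<N. ((real (Suc k) + x) / (real k + x)) ^ Suc k) * (\<Prod>k<N. exp (- 1 + (x - 1/2) / real (Suc k)))"
    by (simp add: prod_dividef [symmetric] prod.distrib [symmetric])
  also have "(\<Prod>k<N. exp (- 1 + (x - 1/2) / real (Suc k))) = exp (- real N + (x - 1/2) * harm N)"
  proof (induction N)
    case (Suc N)
    then show ?case
      by (simp add: harm_Suc exp_add [symmetric] field_simps del: of_nat_Suc)
         (simp add: field_simps)
  qed (simp add: harm_def)
  also have "(\<Prod>k<N. ((real (Suc k) + x) / (real k + x)) ^ Suc k) = (real N + x) ^ N / pochhammer x N"
  proof (induction N)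
    case (Suc N)
    have "real N + x \<noteq> 0" using assms by simp
    then have "(real N + x) ^ N / pochhammer x N * ((real (Suc N) + x) ^ Suc N / (real N + x) ^ Suc N) =
        (real (Suc N) + x) ^ Suc N / pochhammer x (Suc N)"
      by (simp add: pochhammer_Suc add.commute)
    then show ?case by (simp only: Suc prod.lessThan_Suc) (simp only: power_divide)
  qed simp
  finally show ?thesis .
qed

lemma barnes_factor_ratio_LIMSEQ:
  assumes "x > 0"
  shows "(\<lambda>N. (real N + x) ^ N / pochhammer x N * exp (- real N + (x - 1/2) * harm N))
    \<longlonglongrightarrow> prodinf (barnes_factor x) / prodinf (barnes_factor (x - 1))"
  unfolding barnes_factor_ratio [OF assms, symmetric]
  using barnes_factor_convergent_prod [of x] barnes_factor_convergent_prod [of "x - 1"] assms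
  by (intro tendsto_divide has_prod_imp_tendsto') (auto intro: convergent_prod_has_prod)

text \<open>That \<open>stirling_ratio\<close> converges at all follows from the convergence of the Weierstrass
  products at 1 and 0; the value of the limit comes from \<open>\<Gamma>(1/2)\<close> by comparing \<open>N\<close> with \<open>2N\<close>.\<close>

definition stirling_ratio :: "nat \<Rightarrow> real" where
  "stirling_ratio N = fact N / (sqrt (real N) * real N ^ N * exp (- real N))"

lemma exp_harm_LIMSEQ: "(\<lambda>N. exp (c * (harm N - ln (real N)))) \<longlonglongrightarrow> exp (c * euler_mascheroni)"
  by (intro tendsto_intros euler_mascheroni_LIMSEQ)

text \<open>Separates factors whose limits can be found one by one: an exponential limit, the
  Euler-Mascheroni limit, Stirling's ratio and Euler's sequence for \<open>Gamma x\<close>.\<close>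

lemma barnes_ratio_split:
  assumes "N > 0"
  shows "(real N + x) ^ N / pochhammer x N * exp (- real N + (x - 1/2) * harm N) =
    (1 + x / real N) ^ N * exp ((x - 1/2) * (harm N - ln (real N))) / stirling_ratio N *
     (fact N * exp (x * ln (real N)) / real N / pochhammer x N)"
proof -
  have N: "real N > 0" using assms by simp
  have "(real N + x) ^ N = (1 + x / real N) ^ N * real N ^ N"
    using N by (simp add: power_mult_distrib [symmetric] field_simps)
  moreover have "exp (- real N + (x - 1/2) * harm N) =
     exp (- real N) * exp ((x - 1/2) * (harm N - ln (real N))) * exp (x * ln (real N)) * (sqrt (real N) / real N)"
  proof -
    have "exp (- (1/2 * ln (real N))) = sqrt (real N) / real N"
      using N by (simp add: exp_minus ln_sqrt [symmetric] real_div_sqrt inverse_eq_divide)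
        (simp add: field_simps)
    moreover have "exp (- real N + (x - 1/2) * harm N) =
        exp (- real N) * exp ((x - 1/2) * (harm N - ln (real N))) * exp (x * ln (real N)) * exp (- (1/2 * ln (real N)))"
      by (simp add: exp_add [symmetric] algebra_simps)
    ultimately show ?thesis by (simp only:)
  qed
  ultimately show ?thesis
    using N by (simp only: stirling_ratio_def) (simp add: divide_simps)
qed

text \<open>\<open>Gamma_series x N\<close> divides by \<open>pochhammer x (N + 1)\<close>, one
  factor \<open>x + real N\<close> more than in the split above. The correction
  \<open>(x + real N) / real N\<close> tends to 1.\<close>

lemma Gamma_series_mult:
  assumes "x > (0::real)"
  shows "Gamma_series x N * ((x + real N) / real N) = fact N * exp (x * ln (real N)) / real N / pochhammer x N"
proof -
  have "x + real N > 0" "pochhammer x N > 0"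
    using assms by (auto simp: pochhammer_pos)
  then show ?thesis
    by (simp add: Gamma_series_def pochhammer_Suc)
qed

lemma stirling_ratio_LIMSEQ: "stirling_ratio \<longlonglongrightarrow> sqrt (2 * pi)"
proof -
  \<comment> \<open>Solving the split at x = 1 for \<open>stirling_ratio\<close> gives this limit,
    because the Gamma factor there is identically 1.\<close>
  define L where "L = exp 1 * exp (1/2 * euler_mascheroni) /
     (prodinf (barnes_factor 1) / prodinf (barnes_factor 0))"
  have "prodinf (barnes_factor 1) > 0" "prodinf (barnes_factor 0) > 0"
    by (rule barnes_factor_convergent_prod; simp)+
  then have "L > 0" by (simp add: L_def)
  have "(\<lambda>N. (1 + 1 / real N) ^ N * exp (1/2 * (harm N - ln (real N))) /
      ((real N + 1) ^ N / pochhammer 1 N * exp (- real N + (1 - 1/2) * harm N))) \<longlonglongrightarrow> L"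
    unfolding L_def using \<open>prodinf (barnes_factor 1) > 0\<close> \<open>prodinf (barnes_factor 0) > 0\<close>
      barnes_factor_ratio_LIMSEQ [of 1]
    by (intro tendsto_divide tendsto_mult exp_harm_LIMSEQ tendsto_exp_limit_sequentially) auto
  moreover have "eventually (\<lambda>N. (1 + 1 / real N) ^ N * exp (1/2 * (harm N - ln (real N))) /
      ((real N + 1) ^ N / pochhammer 1 N * exp (- real N + (1 - 1/2) * harm N)) = stirling_ratio N) sequentially"
    using eventually_gt_at_top [of 0]
  proof eventually_elim
    case (elim N)
    have "1 + 1 / real N > 0" by (simp add: add_pos_nonneg)
    moreover have "(1 + 1 / real N) ^ N > 0" by (intro zero_less_power) (auto simp: add_pos_nonneg)
    moreover have "stirling_ratio N > 0" using elim by (simp add: stirling_ratio_def)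
    moreover have "fact N * exp (1 * ln (real N)) / real N / pochhammer 1 N = (1 :: real)"
      using elim by (simp add: pochhammer_fact [symmetric])
    moreover have "(1::real) - 1/2 = 1/2" by simp
    ultimately show ?case
      unfolding barnes_ratio_split [OF elim] by (simp only:) simp
  qed
  ultimately have L: "stirling_ratio \<longlonglongrightarrow> L"
    by (rule Lim_transform_eventually)
  \<comment> \<open>This quotient tends to L^2 / L = L. Since (2N)! is 4^N N!
    \<open>pochhammer (1/2) N\<close>, it is also sqrt 2 times a sequence tending to
    \<open>Gamma (1/2)\<close>, which determines L.\<close>
  have "(\<lambda>N. stirling_ratio N ^ 2 / stirling_ratio (2 * N)) \<longlonglongrightarrow> L ^ 2 / L"
    using \<open>L > 0\<close> by (intro tendsto_intros L filterlim_compose [OF L] filterlim_subseq)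
                       (auto simp: strict_mono_def)
  moreover have "(\<lambda>N. sqrt 2 * (Gamma_series (1/2) N * ((1/2 + real N) / real N))) \<longlonglongrightarrow> sqrt 2 * (Gamma (1/2) * 1)"
    by (intro tendsto_intros Gamma_series_LIMSEQ) real_asymp
  moreover have "eventually (\<lambda>N. sqrt 2 * (Gamma_series (1/2) N * ((1/2 + real N) / real N)) =
       stirling_ratio N ^ 2 / stirling_ratio (2 * N)) sequentially"
    using eventually_gt_at_top [of 0]
  proof eventually_elim
    case (elim N)
    have N: "real N > 0" using elim by simp
    have p: "pochhammer (1/2 :: real) N > 0" by (rule pochhammer_pos) simp
    have 1: "exp (1/2 * ln (real N)) = sqrt (real N)"
      using N by (simp add: ln_sqrt [symmetric])
    have 2: "real N ^ (2 * N) = (real N ^ N)\<^sup>2" "exp (- real (2 * N)) = (exp (- real N))\<^sup>2"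
      "sqrt (real N) * sqrt (real N) = real N"
      by (simp_all add: power_mult power_even_eq exp_double [symmetric] mult.commute)
    have G: "Gamma_series (1/2) N * ((1/2 + real N) / real N) = fact N * sqrt (real N) / (pochhammer (1/2) N * real N)"
      by (simp add: Gamma_series_mult [simplified] 1 [simplified])
    have "stirling_ratio N ^ 2 / stirling_ratio (2 * N) =
        (fact N / (sqrt (real N) * real N ^ N * exp (- real N))) ^ 2 *
        (sqrt 2 * sqrt (real N) * (2 ^ (2 * N) * (real N ^ N)\<^sup>2) * (exp (- real N))\<^sup>2) /
        (2 ^ (2 * N) * pochhammer (1 / 2) N * fact N)"
      by (simp add: stirling_ratio_def fact_double [of N, where 'a = real] power_mult_distrib 2 [simplified] real_sqrt_mult)
    also have "\<dots> = sqrt 2 * (fact N * sqrt (real N) / (pochhammer (1/2) N * real N))"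
      using N p by (simp add: field_simps power2_eq_square)
    finally show ?case by (simp only: G)
  qed
  ultimately have "L ^ 2 / L = sqrt 2 * (Gamma (1/2) * 1)"
    by (blast intro: LIMSEQ_unique Lim_transform_eventually)
  then have "L = sqrt (2 * pi)"
    using \<open>L > 0\<close> by (simp add: power2_eq_square Gamma_one_half_real real_sqrt_mult)
  with L show ?thesis by simp
qed

text \<open>The limit of the split evaluates the quotient of the two infinite products. Its factor 1
  / sqrt (2 pi) and its exponentials cancel against the change of the prefactors from x - 1 to x, so
  that only \<open>Gamma x\<close> survives.\<close>

lemma barnesG_plus1:
  assumes "x > 0"
  shows "barnesG (x + 1) = Gamma x * barnesG x"
proof -
  have lim: "(\<lambda>N. (1 + x / real N) ^ N * exp ((x - 1/2) * (harm N - ln (real N))) / stirling_ratio N *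
     (Gamma_series x N * ((x + real N) / real N))) \<longlonglongrightarrow>
    exp x * exp ((x - 1/2) * euler_mascheroni) / sqrt (2 * pi) * (Gamma x * 1)"
    by (intro tendsto_intros exp_harm_LIMSEQ tendsto_exp_limit_sequentially stirling_ratio_LIMSEQ Gamma_series_LIMSEQ)
       (real_asymp | simp)+
  have ev: "eventually (\<lambda>N. (1 + x / real N) ^ N * exp ((x - 1/2) * (harm N - ln (real N))) / stirling_ratio N *
     (Gamma_series x N * ((x + real N) / real N)) =
     (real N + x) ^ N / pochhammer x N * exp (- real N + (x - 1/2) * harm N)) sequentially"
    using eventually_gt_at_top [of 0]
  proof eventually_elim
    case (elim N)
    show ?case
      by (subst barnes_ratio_split) (use elim Gamma_series_mult [OF assms, of N] in auto)
  qed
  have "prodinf (barnes_factor x) / prodinf (barnes_factor (x - 1)) =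
    exp x * exp ((x - 1/2) * euler_mascheroni) / sqrt (2 * pi) * (Gamma x * 1)"
    by (rule LIMSEQ_unique [OF barnes_factor_ratio_LIMSEQ [OF assms] Lim_transform_eventually [OF lim ev]])
  moreover have "prodinf (barnes_factor (x - 1)) > 0"
    using barnes_factor_convergent_prod [of "x - 1"] assms by simp
  ultimately have P: "prodinf (barnes_factor x) = prodinf (barnes_factor (x - 1)) *
      exp x * exp ((x - 1/2) * euler_mascheroni) / sqrt (2 * pi) * Gamma x"
    by (simp add: field_simps)
  have p: "(2 * pi) powr (x / 2) = (2 * pi) powr ((x - 1) / 2) * sqrt (2 * pi)"
    by (simp add: powr_half_sqrt [symmetric] powr_add [symmetric] diff_divide_distrib)
  have e: "exp (- (1/2) * (x - 1) * (x - 1 + 1) - (1/2) * euler_mascheroni * (x - 1)\<^sup>2) =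
      exp (- (1/2) * x * (x + 1) - (1/2) * euler_mascheroni * x\<^sup>2) * exp x * exp ((x - 1/2) * euler_mascheroni)"
    unfolding exp_add [symmetric]
    by (rule arg_cong [of _ _ exp]) (simp add: field_simps power2_eq_square)
  have "barnesG x = (2 * pi) powr ((x - 1) / 2) * exp (- (1/2) * (x - 1) * (x - 1 + 1) - (1/2) * euler_mascheroni * (x - 1)\<^sup>2)
     * prodinf (barnes_factor (x - 1))"
    using barnesG_altdef [of "x - 1"] by simp
  then show ?thesis
    unfolding barnesG_altdef P p e by (simp add: field_simps)
qed

subsection \<open>Hankel determinants of Gamma and Beta values\<close>

abbreviation mdet :: "nat \<Rightarrow> (nat \<Rightarrow> nat \<Rightarrow> 'a :: comm_ring_1) \<Rightarrow> 'a" where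
  "mdet n f \<equiv> Determinant.det (Matrix.mat n n (\<lambda>(i, j). f i j))"

lemma mdet_Leibniz:
  "mdet n f = (\<Sum>p | p permutes {0..<n}. signof p * (\<Prod>i = 0..<n. f i (p i)))"
proof -
  have "mdet n f = (\<Sum>p | p permutes {0..<n}. signof p *
      (\<Prod>i = 0..<n. Matrix.mat n n (\<lambda>(i, j). f i j) $$ (i, p i)))"
    by (rule det_def') simp
  also have "\<dots> = (\<Sum>p | p permutes {0..<n}. signof p * (\<Prod>i = 0..<n. f i (p i)))"
    by (intro sum.cong prod.cong arg_cong2 [of _ _ _ _ "(*)"]) (auto dest: permutes_in_image)
  finally show ?thesis .
qed

lemma mdet_cong:
  assumes "\<And>i j. i < n \<Longrightarrow> j < n \<Longrightarrow> f i j = g i j"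
  shows "mdet n f = mdet n g"
  using assms by (intro arg_cong [of _ _ Determinant.det] eq_matI) auto

text \<open>Each Leibniz term takes exactly one entry from every row and every column.\<close>

lemma mdet_scale:
  "mdet n (\<lambda>i j. r i * c j * f i j) = (\<Prod>i<n. r i) * (\<Prod>j<n. c j) * mdet n f"
proof -
  have "(\<Prod>i = 0..<n. r i * c (p i) * f i (p i)) =
      (\<Prod>i<n. r i) * (\<Prod>j<n. c j) * (\<Prod>i = 0..<n. f i (p i))" if "p permutes {0..<n}" for p
    using prod.permute [OF that, of c] by (simp add: prod.distrib atLeast0LessThan o_def)
  then show ?thesis
    by (simp add: mdet_Leibniz sum_distrib_left mult_ac)
qed

lemma mdet_mult:
  "mdet n (\<lambda>i j. \<Sum>k<n. f i k * g k j) = mdet n f * mdet n g"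
proof -
  have "Matrix.mat n n (\<lambda>(i, j). f i j) * Matrix.mat n n (\<lambda>(i, j). g i j) =
      Matrix.mat n n (\<lambda>(i, j). \<Sum>k<n. f i k * g k j)"
    by (intro eq_matI) (auto simp: scalar_prod_def atLeast0LessThan)
  then show ?thesis
    by (subst det_mult [of _ n, symmetric]) auto
qed

lemma mdet_transpose: "mdet n (\<lambda>i j. f j i) = mdet n f"
proof -
  have "Matrix.mat n n (\<lambda>(i, j). f j i) = transpose_mat (Matrix.mat n n (\<lambda>(i, j). f i j))"
    by (intro eq_matI) auto
  then show ?thesis by (simp add: det_transpose [of _ n])
qed

lemma mdet_lower_triangular:
  assumes "\<And>i j. i < j \<Longrightarrow> j < n \<Longrightarrow> f i j = 0"
  shows "mdet n f = (\<Prod>i<n. f i i)"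
proof -
  have "mdet n f = prod_list (diag_mat (Matrix.mat n n (\<lambda>(i, j). f i j)))"
    by (rule det_lower_triangular [of n]) (use assms in auto)
  also have "diag_mat (Matrix.mat n n (\<lambda>(i, j). f i j)) = map (\<lambda>i. f i i) [0..<n]"
    by (auto simp: diag_mat_def)
  finally show ?thesis
    by (simp add: prod.distinct_set_conv_list [symmetric] atLeast0LessThan)
qed

lemma mdet_upper_triangular:
  assumes "\<And>i j. j < i \<Longrightarrow> i < n \<Longrightarrow> f i j = 0"
  shows "mdet n f = (\<Prod>i<n. f i i)"
  by (subst mdet_transpose [symmetric], rule mdet_lower_triangular) (use assms in auto)

lemma tendsto_mdet:
  fixes f :: "'b \<Rightarrow> nat \<Rightarrow> nat \<Rightarrow> real"
  assumes "\<And>i j. i < n \<Longrightarrow> j < n \<Longrightarrow> ((\<lambda>t. f t i j) \<longlongrightarrow> g i j) F"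
  shows "((\<lambda>t. mdet n (f t)) \<longlongrightarrow> mdet n g) F"
  unfolding mdet_Leibniz
  by (intro tendsto_intros assms) (auto dest: permutes_in_image)

text \<open>The matrix is diagonally equivalent to \<open>(a + i + j - 1 choose j)\<close>, which Vandermonde's convolution
  factors into two unitriangular matrices.\<close>

lemma mdet_Gamma_Hankel:
  fixes a :: real
  assumes "a > 0"
  shows "mdet n (\<lambda>i j. Gamma (a + real i + real j)) = (\<Prod>j<n. fact j * Gamma (a + real j))"
proof -
  have "mdet n (\<lambda>i j. Gamma (a + real i + real j)) =
     mdet n (\<lambda>i j. Gamma (a + real i) * fact j * (real i + (a + real j - 1) gchoose j))"
  proof (rule mdet_cong)
    fix i j :: nat
    have "a + real i > 0" using assms by simp
    then have "a + real i \<notin> \<int>\<^sub>\<le>\<^sub>0" by (auto elim!: nonpos_Ints_cases)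
    then have "pochhammer (a + real i) j = Gamma (a + real i + real j) / Gamma (a + real i)"
      by (rule pochhammer_Gamma)
    moreover have "fact j * (real i + (a + real j - 1) gchoose j) = pochhammer (a + real i) j"
      by (simp add: gbinomial_pochhammer' algebra_simps)
    moreover have "Gamma (a + real i) > 0" using \<open>a + real i > 0\<close> by (rule Gamma_real_pos)
    ultimately show "Gamma (a + real i + real j) = Gamma (a + real i) * fact j * (real i + (a + real j - 1) gchoose j)"
      by (simp add: mult.assoc)
  qed
  also have "\<dots> = (\<Prod>i<n. Gamma (a + real i)) * (\<Prod>j<n. fact j) *
      mdet n (\<lambda>i j. real i + (a + real j - 1) gchoose j)"
    by (rule mdet_scale)
  \<comment> \<open>Vandermonde's convolution separates i from j. The explicit 0 for k > j matters:
    there \<open>j - k\<close> is 0 on the naturals, and the binomial would be 1.\<close>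
  also have "mdet n (\<lambda>i j. real i + (a + real j - 1) gchoose j) =
      mdet n (\<lambda>i j. \<Sum>k<n. (real i gchoose k) * (if k \<le> j then (a + real j - 1) gchoose (j - k) else 0))"
  proof (rule mdet_cong)
    fix i j :: nat
    assume "j < n"
    have "(\<Sum>k<n. (real i gchoose k) * (if k \<le> j then (a + real j - 1) gchoose (j - k) else 0)) =
        (\<Sum>k\<in>{0..j}. (real i gchoose k) * ((a + real j - 1) gchoose (j - k)))"
      using \<open>j < n\<close> by (intro sum.mono_neutral_cong_right) auto
    then show "real i + (a + real j - 1) gchoose j =
        (\<Sum>k<n. (real i gchoose k) * (if k \<le> j then (a + real j - 1) gchoose (j - k) else 0))"
      by (simp only: gbinomial_Vandermonde)
  qed
  also have "\<dots> = mdet n (\<lambda>i k. real i gchoose k) *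
      mdet n (\<lambda>k j. if k \<le> j then (a + real j - 1) gchoose (j - k) else 0)"
    by (rule mdet_mult)
  also have "mdet n (\<lambda>i k. real i gchoose k) = (\<Prod>i<n. real i gchoose i)"
    by (rule mdet_lower_triangular) (auto simp: binomial_gbinomial [symmetric])
  also have "mdet n (\<lambda>k j. if k \<le> j then (a + real j - 1) gchoose (j - k) else 0) = (\<Prod>i<n. 1)"
    by (subst mdet_upper_triangular) auto
  finally show ?thesis
    by (simp add: binomial_gbinomial [symmetric] prod.distrib)
qed

text \<open>The sum is the binomial expansion of \<open>(1 - x) ^ m\<close> under the Beta
  integral.\<close>

lemma Beta_binomial_sum:
  fixes a b :: real
  assumes "a > 0" "b > 0"
  shows "(\<Sum>k\<le>m. (-1) ^ k * real (m choose k) * Beta (a + real k) b) = Beta a (b + real m)"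
proof -
  \<comment> \<open>Dropping the endpoints leaves the integral unchanged and makes x and 1 - x
    positive, as converting \<open>powr\<close> to natural powers requires.\<close>
  have "((\<lambda>x. \<Sum>k\<le>m. (-1) ^ k * real (m choose k) * (x powr (a + real k - 1) * (1 - x) powr (b - 1)))
      has_integral (\<Sum>k\<le>m. (-1) ^ k * real (m choose k) * Beta (a + real k) b)) {0<..<1}"
    using assms has_integral_Beta_real
    by (intro has_integral_sum has_integral_mult_right) (auto simp flip: has_integral_Icc_iff_Ioo)
  moreover have "(\<Sum>k\<le>m. (-1) ^ k * real (m choose k) * (x powr (a + real k - 1) * (1 - x) powr (b - 1))) =
      x powr (a - 1) * (1 - x) powr (b + real m - 1)" if "x \<in> {0<..<1}" for x
  proof -
    have "(1 - x) ^ m = (\<Sum>k\<le>m. real (m choose k) * (- x) ^ k)"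
      using binomial_ring [of "- x" 1 m] by simp
    moreover have "x powr (a + real k - 1) = x powr (a - 1) * x ^ k" for k
      using that by (simp add: powr_add [symmetric] powr_realpow [symmetric] algebra_simps)
    moreover have "(1 - x) powr (b + real m - 1) = (1 - x) powr (b - 1) * (1 - x) ^ m"
      using that by (simp add: powr_add [symmetric] powr_realpow [symmetric] algebra_simps)
    ultimately show ?thesis
      by (simp add: sum_distrib_left power_minus [of x] mult_ac)
  qed
  ultimately have "((\<lambda>x. x powr (a - 1) * (1 - x) powr (b + real m - 1))
      has_integral (\<Sum>k\<le>m. (-1) ^ k * real (m choose k) * Beta (a + real k) b)) {0<..<1}"
    by (rule has_integral_eq [rotated])
  moreover have "((\<lambda>x. x powr (a - 1) * (1 - x) powr (b + real m - 1)) has_integral Beta a (b + real m)) {0<..<1}"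
    using has_integral_Beta_real [of a "b + real m"] assms by (simp flip: has_integral_Icc_iff_Ioo)
  ultimately show ?thesis by (rule has_integral_unique)
qed

text \<open>Multiplying the moments by the lower unitriangular coefficient matrix of
  \<open>x ^ j * (1 - x) ^ (n - 1 - j)\<close> turns the Beta function into a quotient of Gamma functions in
  which \<open>i\<close> and \<open>j\<close> interact only through \<open>\<Gamma>(a + i + j)\<close>.\<close>

lemma mdet_Beta_Hankel:
  fixes a b :: real
  assumes "a > 0" "b > 0"
  shows "mdet n (\<lambda>i j. Beta (a + real (i + j)) b) =
    (\<Prod>j<n. fact j * Gamma (a + real j) * Gamma (b + real j) / Gamma (a + b + real (n + j) - 1))"
proof -
  define T :: "nat \<Rightarrow> nat \<Rightarrow> real"
    where "T k j = (if j \<le> k \<and> k < n then (-1) ^ (k - j) * real ((n - 1 - j) choose (k - j)) else 0)" for k j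
  have "mdet n T = (\<Prod>i<n. T i i)"
    by (rule mdet_lower_triangular) (auto simp: T_def)
  also have "\<dots> = 1" by (simp add: T_def)
  finally have T1: "mdet n T = 1" .
  have row: "(\<Sum>k<n. Beta (a + real (i + k)) b * T k j) = Beta (a + real (i + j)) (b + real (n - 1 - j))"
    if "j < n" for i j
  proof -
    have "(\<Sum>k<n. Beta (a + real (i + k)) b * T k j) =
        (\<Sum>k\<in>{j..n-1}. Beta (a + real (i + k)) b * ((-1) ^ (k - j) * real ((n - 1 - j) choose (k - j))))"
      by (rule sum.mono_neutral_cong_right) (use that in \<open>auto simp: T_def\<close>)
    also have "\<dots> = (\<Sum>k\<le>n-1-j. (-1) ^ k * real ((n - 1 - j) choose k) * Beta (a + real (i + j) + real k) b)"
      by (rule sum.reindex_bij_witness [of _ "\<lambda>k. k + j" "\<lambda>k. k - j"]) (use that in \<open>auto simp: algebra_simps\<close>)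
    also have "\<dots> = Beta (a + real (i + j)) (b + real (n - 1 - j))"
      using assms by (intro Beta_binomial_sum) auto
    finally show ?thesis .
  qed
  have "mdet n (\<lambda>i j. Beta (a + real (i + j)) b) =
      mdet n (\<lambda>i j. \<Sum>k<n. Beta (a + real (i + k)) b * T k j)"
    by (simp add: mdet_mult T1)
  also have "\<dots> = mdet n (\<lambda>i j. (1 / Gamma (a + b + real (n + i) - 1)) * Gamma (b + real (n - 1 - j)) *
      Gamma (a + real i + real j))"
  proof (rule mdet_cong)
    fix i j assume "i < n" "j < n"
    \<comment> \<open>In the sum of the two Beta arguments j cancels, so the denominator is a pure
      row factor.\<close>
    then have "a + real (i + j) + (b + real (n - 1 - j)) = a + b + real (n + i) - 1"
      by (simp add: of_nat_diff)
    then have "Beta (a + real (i + j)) (b + real (n - 1 - j)) =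
        (1 / Gamma (a + b + real (n + i) - 1)) * Gamma (b + real (n - 1 - j)) * Gamma (a + real i + real j)"
      by (simp only: Beta_def) (simp add: add.assoc)
    then show "(\<Sum>k<n. Beta (a + real (i + k)) b * T k j) =
        (1 / Gamma (a + b + real (n + i) - 1)) * Gamma (b + real (n - 1 - j)) * Gamma (a + real i + real j)"
      by (simp only: row [OF \<open>j < n\<close>])
  qed
  also have "\<dots> = (\<Prod>i<n. 1 / Gamma (a + b + real (n + i) - 1)) * (\<Prod>j<n. Gamma (b + real (n - 1 - j))) *
      (\<Prod>j<n. fact j * Gamma (a + real j))"
    using assms(1) by (simp only: mdet_scale mdet_Gamma_Hankel)
  also have "(\<Prod>j<n. Gamma (b + real (n - 1 - j))) = (\<Prod>j<n. Gamma (b + real j))"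
    by (rule prod.reindex_bij_witness [of _ "\<lambda>j. n - 1 - j" "\<lambda>j. n - 1 - j"]) auto
  finally show ?thesis
    by (simp add: prod.distrib [symmetric] mult_ac)
qed

subsection \<open>The constant as a product of Gamma values\<close>

text \<open>The coefficient of part (i); part (ii) has \<alpha> in place of \<beta>. It repeats the
  expression of the theorem literally, so that unfolding alone finishes the proof.\<close>

definition barnes_const :: "nat \<Rightarrow> real \<Rightarrow> real \<Rightarrow> real" where
  "barnes_const n \<beta> \<gamma> = 2 powr (- 2 * real n * (real n + \<beta> + \<gamma>)) * (2 * pi) ^ n
             * (Gamma ((\<beta> + \<gamma> + 1) / 2) * (barnesG ((\<beta> + \<gamma> + 1) / 2))^2
                * (barnesG ((\<beta> + \<gamma>) / 2 + 1))^2
                / (barnesG (\<beta> + \<gamma> + 1) * barnesG (\<beta> + 1) * barnesG (\<gamma> + 1)))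
             * (barnesG (real n + 1) * barnesG (real n + \<beta> + 1) * barnesG (real n + \<gamma> + 1)
                * barnesG (real n + \<beta> + \<gamma> + 1)
                / ((barnesG (real n + (\<beta> + \<gamma> + 1) / 2))^2 * (barnesG (real n + (\<beta> + \<gamma>) / 2 + 1))^2
                   * Gamma (real n + (\<beta> + \<gamma> + 1) / 2)))"

section \<open>Gamma products from the recurrence and the duplication formula\<close>

lemma barnesG_add_nat:
  assumes "z > 0"
  shows "barnesG (z + real n) = barnesG z * (\<Prod>j<n. Gamma (z + real j))"
proof (induction n)
  case (Suc n)
  have "barnesG (z + real n + 1) = Gamma (z + real n) * barnesG (z + real n)"
    using assms by (intro barnesG_plus1) simp
  with Suc show ?case by (simp add: add_ac mult_ac)
qed simp

lemma barnesG_one: "barnesG 1 = 1"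
  using barnesG_altdef [of 0] by (simp add: barnes_factor_def [abs_def])

lemma barnesG_nat: "barnesG (real n + 1) = (\<Prod>j<n. fact j)"
  using barnesG_add_nat [of 1 n] by (simp add: barnesG_one Gamma_fact add_ac)

lemma Gamma_duplication_real:
  assumes "z > (0::real)"
  shows "Gamma z * Gamma (z + 1/2) = 2 powr (1 - 2 * z) * sqrt pi * Gamma (2 * z)"
proof -
  have "z \<notin> \<int>\<^sub>\<le>\<^sub>0" "z + 1/2 \<notin> \<int>\<^sub>\<le>\<^sub>0" using assms by (auto elim!: nonpos_Ints_cases)
  then have "complex_of_real z \<notin> \<int>\<^sub>\<le>\<^sub>0" "complex_of_real (z + 1/2) \<notin> \<int>\<^sub>\<le>\<^sub>0"
    by (simp_all only: of_real_in_nonpos_Ints_iff not_False_eq_True)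
  then have "complex_of_real z \<notin> \<int>\<^sub>\<le>\<^sub>0" "complex_of_real z + 1/2 \<notin> \<int>\<^sub>\<le>\<^sub>0" by simp_all
  from Gamma_legendre_duplication [OF this]
  have "complex_of_real (Gamma z * Gamma (z + 1/2)) =
      complex_of_real (exp ((1 - 2 * z) * ln 2) * sqrt pi * Gamma (2 * z))"
    by (simp add: exp_of_real [symmetric] Gamma_complex_of_real [symmetric])
  then show ?thesis by (simp only: of_real_eq_iff) (simp add: powr_def)
qed

text \<open>A relative duplication formula for G: both sides agree at n = 0, and the induction step
  is the square of Legendre's formula at z = n + (s + 1)/2. Normalising at n = 0 avoids the absolute
  constant of the full duplication formula.\<close>

lemma barnesG_duplication_nat:
  assumes "s > 0"
  shows "2 powr (- 2 * real n * (real n + s)) * (2 * pi) ^ n *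
      (Gamma ((s + 1) / 2) * (barnesG ((s + 1) / 2))\<^sup>2 * (barnesG (s / 2 + 1))\<^sup>2) * barnesG (2 * real n + s + 1) =
    barnesG (s + 1) * ((barnesG (real n + (s + 1) / 2))\<^sup>2 * (barnesG (real n + s / 2 + 1))\<^sup>2 *
      Gamma (real n + (s + 1) / 2))"
proof (induction n)
  case (Suc n)
  define z where "z = real n + (s + 1) / 2"
  have z: "z > 0" using assms unfolding z_def by (intro add_nonneg_pos) auto
  define K where "K = Gamma ((s + 1) / 2) * (barnesG ((s + 1) / 2))\<^sup>2 * (barnesG (s / 2 + 1))\<^sup>2"
  have z_eqs: "real n + (s + 1) / 2 = z" "real n + s / 2 + 1 = z + 1/2" "2 * real n + s + 1 = 2 * z"
     "real (Suc n) + (s + 1) / 2 = z + 1" "real (Suc n) + s / 2 + 1 = (z + 1/2) + 1"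
     "2 * real (Suc n) + s + 1 = 2 * z + 1 + 1"
    by (simp_all add: z_def field_simps)
  have e: "- 2 * real (Suc n) * (real (Suc n) + s) = - 2 * real n * (real n + s) + - 4 * z"
    by (simp add: z_def field_simps)
  have d: "(Gamma z)\<^sup>2 * (Gamma (z + 1/2))\<^sup>2 = 2 powr (2 - 4 * z) * pi * (Gamma (2 * z))\<^sup>2"
  proof -
    have "(2 powr (1 - 2 * z))\<^sup>2 = 2 powr (2 - 4 * z)"
      by (simp add: power2_eq_square powr_add [symmetric])
    then show ?thesis
      unfolding power_mult_distrib [symmetric] Gamma_duplication_real [OF z]
      by (simp add: power_mult_distrib)
  qed
  have p: "2 powr (2 - 4 * z) = 4 * 2 powr (- 4 * z)"
    by (simp add: powr_diff powr_minus divide_inverse)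
  have G: "barnesG (2 * z + 1 + 1) = 2 * z * Gamma (2 * z) * (Gamma (2 * z) * barnesG (2 * z))"
  proof -
    have "Gamma (2 * z + 1) = 2 * z * Gamma (2 * z)"
      using z by (intro Gamma_plus1) (auto elim!: nonpos_Ints_cases)
    then show ?thesis
      using z barnesG_plus1 [of "2 * z"] barnesG_plus1 [of "2 * z + 1"] by simp
  qed
  \<comment> \<open>The new factor 2 pi and the 2 z coming from \<open>Gamma (2 * z + 1)\<close>
    combine to 4 pi z. The 4 completes the power of 2 in the squared duplication formula; the z
    raises \<open>Gamma z\<close> to \<open>Gamma (z + 1)\<close>.\<close>
  have "2 powr (- 2 * real (Suc n) * (real (Suc n) + s)) * (2 * pi) ^ Suc n * K * barnesG (2 * z + 1 + 1) =
      (2 powr (- 2 * real n * (real n + s)) * (2 * pi) ^ n * K * barnesG (2 * z)) *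
      (4 * 2 powr (- 4 * z) * pi * (Gamma (2 * z))\<^sup>2) * z"
    unfolding e powr_add G by (simp add: power2_eq_square)
  also have "2 powr (- 2 * real n * (real n + s)) * (2 * pi) ^ n * K * barnesG (2 * z) =
      barnesG (s + 1) * ((barnesG z)\<^sup>2 * (barnesG (z + 1/2))\<^sup>2 * Gamma z)"
    using Suc unfolding z_eqs K_def .
  also have "4 * 2 powr (- 4 * z) * pi * (Gamma (2 * z))\<^sup>2 = (Gamma z)\<^sup>2 * (Gamma (z + 1/2))\<^sup>2"
    by (simp only: d p)
  also have "barnesG (s + 1) * ((barnesG z)\<^sup>2 * (barnesG (z + 1/2))\<^sup>2 * Gamma z) *
      ((Gamma z)\<^sup>2 * (Gamma (z + 1/2))\<^sup>2) * z =
     barnesG (s + 1) * ((Gamma z * barnesG z)\<^sup>2 * (Gamma (z + 1/2) * barnesG (z + 1/2))\<^sup>2 * (z * Gamma z))"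
    by (simp add: power_mult_distrib)
  also have "z * Gamma z = Gamma (z + 1)"
    using z by (intro Gamma_plus1 [symmetric]) (auto elim!: nonpos_Ints_cases)
  also have "Gamma z * barnesG z = barnesG (z + 1)"
    using z by (simp add: barnesG_plus1)
  also have "Gamma (z + 1/2) * barnesG (z + 1/2) = barnesG (z + 1/2 + 1)"
    using z by (intro barnesG_plus1 [symmetric]) simp
  finally show ?case unfolding z_eqs K_def .
qed (simp add: mult_ac)

text \<open>The duplication identity collapses all half-argument factors to 1 / G(2n + s + 1). Every
  remaining quotient shifts an argument by n and is a product of Gamma values; the result is
  \<open>mdet_Beta_Hankel\<close> at a = \<beta> + 1, b = \<gamma> + 1.\<close>

lemma barnes_const_eq_prod:
  assumes "\<beta> > 0" "\<gamma> > 0"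
  shows "barnes_const n \<beta> \<gamma> =
    (\<Prod>j<n. fact j * Gamma (\<beta> + 1 + real j) * Gamma (\<gamma> + 1 + real j) / Gamma (\<beta> + \<gamma> + 1 + real (n + j)))"
proof -
  define s where "s = \<beta> + \<gamma>"
  have s: "s > 0" using assms by (simp add: s_def)
  define X where "X = 2 powr (- 2 * real n * (real n + s)) * (2 * pi) ^ n *
      (Gamma ((s + 1) / 2) * (barnesG ((s + 1) / 2))\<^sup>2 * (barnesG (s / 2 + 1))\<^sup>2)"
  define Y where "Y = (barnesG (real n + (s + 1) / 2))\<^sup>2 * (barnesG (real n + s / 2 + 1))\<^sup>2 *
      Gamma (real n + (s + 1) / 2)"
  have Y: "Y > 0" using s
    unfolding Y_def by (intro mult_pos_pos barnesG_pos zero_less_power Gamma_real_pos add_nonneg_pos) auto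
  have pos: "barnesG (s + 1) > 0" "barnesG (\<beta> + 1) > 0" "barnesG (\<gamma> + 1) > 0" "barnesG (2 * real n + s + 1) > 0"
     "barnesG (real n + s + 1) > 0"
    using assms s by (auto intro!: barnesG_pos)
  have "X * barnesG (2 * real n + s + 1) = barnesG (s + 1) * Y"
    unfolding X_def Y_def using barnesG_duplication_nat [OF s, of n] .
  then have XY: "X / (barnesG (s + 1) * Y) = 1 / barnesG (2 * real n + s + 1)"
    using Y pos by (simp add: field_simps)
  have "barnes_const n \<beta> \<gamma> = X / (barnesG (s + 1) * Y) * barnesG (real n + 1) *
      (barnesG (\<beta> + 1 + real n) / barnesG (\<beta> + 1)) * (barnesG (\<gamma> + 1 + real n) / barnesG (\<gamma> + 1)) * barnesG (real n + s + 1)"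
    unfolding barnes_const_def X_def Y_def s_def by (simp add: add_ac mult_ac)
  \<comment> \<open>The argument 2n + s + 1 is read as a shift of n + s + 1 by n, which pairs it
    with the numerator G(n + s + 1).\<close>
  also have "\<dots> = barnesG (real n + 1) *
      (barnesG (\<beta> + 1 + real n) / barnesG (\<beta> + 1)) * (barnesG (\<gamma> + 1 + real n) / barnesG (\<gamma> + 1)) *
      (barnesG (real n + s + 1) / barnesG (real n + s + 1 + real n))"
    unfolding XY by (simp add: add_ac)
  also have "\<dots> = (\<Prod>j<n. fact j) * (\<Prod>j<n. Gamma (\<beta> + 1 + real j)) * (\<Prod>j<n. Gamma (\<gamma> + 1 + real j)) *
      (1 / (\<Prod>j<n. Gamma (real n + s + 1 + real j)))"
    using pos(2,3,5) barnesG_add_nat [of "\<beta> + 1" n] barnesG_add_nat [of "\<gamma> + 1" n]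
      barnesG_add_nat [of "real n + s + 1" n] assms s by (simp add: barnesG_nat)
  also have "\<dots> = (\<Prod>j<n. fact j * Gamma (\<beta> + 1 + real j) * Gamma (\<gamma> + 1 + real j) / Gamma (\<beta> + \<gamma> + 1 + real (n + j)))"
    by (simp add: prod.distrib prod_dividef s_def add_ac)
  finally show ?thesis .
qed

subsection \<open>Asymptotics of the determinant\<close>

text \<open>What remains of a moment of the weight on [0, t] after x = t u, once all powers of t are
  taken out.\<close>

definition scaled_moment :: "real \<Rightarrow> real \<Rightarrow> real \<Rightarrow> nat \<Rightarrow> real \<Rightarrow> real" where
  "scaled_moment \<alpha> \<beta> \<gamma> m t = integral {0..1} (\<lambda>u. u ^ m * (u powr \<alpha> * (1 - t * u) powr \<beta> * (1 - u) powr \<gamma>))"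

lemma scaled_moment_integrable:
  fixes \<alpha> \<beta> \<gamma> t :: real
  assumes "\<alpha> > 0" "\<beta> > 0" "\<gamma> > 0" "0 < t" "t < 1"
  shows "(\<lambda>u. u ^ m * (u powr \<alpha> * (1 - t * u) powr \<beta> * (1 - u) powr \<gamma>)) integrable_on {0..1}"
proof -
  have "0 \<le> 1 - t * u \<and> (1 - t * u = 0 \<longrightarrow> 0 < \<beta>)" if "u \<in> {0..1}" for u
    using assms that by (auto intro: mult_le_one)
  then show ?thesis
    using assms by (intro integrable_continuous_interval continuous_intros continuous_on_powr') auto
qed

lemma has_integral_wfun_left:
  fixes \<alpha> \<beta> \<gamma> t :: real
  assumes "\<alpha> > 0" "\<beta> > 0" "\<gamma> > 0" "0 < t" "t < 1"
  shows "((\<lambda>x. x ^ m * wfun \<alpha> \<beta> \<gamma> 1 (-1) x t) has_integral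
    t powr (\<alpha> + \<gamma> + 1) * t ^ m * scaled_moment \<alpha> \<beta> \<gamma> m t) {0..1}"
proof -
  define g where "g x = x ^ m * (x powr \<alpha> * (1 - x) powr \<beta> * (t - x) powr \<gamma>)" for x
  have "g integrable_on {0..t}"
    unfolding g_def using assms
    by (intro integrable_continuous_interval continuous_intros continuous_on_powr') auto
  then obtain J where J: "(g has_integral J) {0..t}" by (auto simp: integrable_on_def)
  have "((\<lambda>u. g (t * u)) has_integral J / t) {0..1}"
    using has_integral_affinity' [of g J 0 t t 0] J \<open>0 < t\<close> by (simp add: divide_inverse mult.commute)
  then have "((\<lambda>u. t ^ m * t powr (\<alpha> + \<gamma>) * (u ^ m * (u powr \<alpha> * (1 - t * u) powr \<beta> * (1 - u) powr \<gamma>)))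
      has_integral J / t) {0..1}"
  proof (rule has_integral_eq [rotated])
    fix u :: real
    assume u: "u \<in> {0..1}"
    have "(t - t * u) powr \<gamma> = t powr \<gamma> * (1 - u) powr \<gamma>"
      using u \<open>0 < t\<close> by (simp add: powr_mult [symmetric] algebra_simps)
    then show "g (t * u) = t ^ m * t powr (\<alpha> + \<gamma>) * (u ^ m * (u powr \<alpha> * (1 - t * u) powr \<beta> * (1 - u) powr \<gamma>))"
      using u \<open>0 < t\<close> by (simp add: g_def powr_mult power_mult_distrib powr_add mult_ac)
  qed
  moreover have "((\<lambda>u. t ^ m * t powr (\<alpha> + \<gamma>) * (u ^ m * (u powr \<alpha> * (1 - t * u) powr \<beta> * (1 - u) powr \<gamma>)))
      has_integral t ^ m * t powr (\<alpha> + \<gamma>) * scaled_moment \<alpha> \<beta> \<gamma> m t) {0..1}"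
    unfolding scaled_moment_def
    by (intro has_integral_mult_right integrable_integral scaled_moment_integrable assms)
  ultimately have "J / t = t ^ m * t powr (\<alpha> + \<gamma>) * scaled_moment \<alpha> \<beta> \<gamma> m t"
    by (rule has_integral_unique)
  then have J_eq: "J = t powr (\<alpha> + \<gamma> + 1) * t ^ m * scaled_moment \<alpha> \<beta> \<gamma> m t"
    using \<open>0 < t\<close> by (simp add: powr_add field_simps)
  \<comment> \<open>With A = 1 and B = -1 the last factor of the weight is 1 for x \<le> t and 0 for
    x > t, so the weight is \<open>g\<close> extended by zero.\<close>
  have "((\<lambda>x. if x \<in> {0..t} then g x else 0) has_integral J) {0..1}"
    using J assms by (subst has_integral_restrict) auto
  then have "((\<lambda>x. x ^ m * wfun \<alpha> \<beta> \<gamma> 1 (-1) x t) has_integral J) {0..1}"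
    by (rule has_integral_eq [rotated]) (auto simp: g_def wfun_def heaviside_def abs_minus_commute)
  then show ?thesis by (simp only: J_eq)
qed

text \<open>The factor t^(i + j) is split between row i and column j; the exponents add up to n(s +
  1) + n(n - 1).\<close>

lemma prod_scaling_factors:
  assumes "t > (0::real)"
  shows "(\<Prod>i<n. t powr (s + 1) * t ^ i) * (\<Prod>j<n. t ^ j) = t powr (real n * (real n + s))"
proof (induction n)
  case (Suc n)
  have "t powr (real (Suc n) * (real (Suc n) + s)) =
      t powr (real n * (real n + s)) * t powr (s + 1) * t powr (real n) * t powr (real n)"
    by (simp add: powr_add [symmetric] algebra_simps)
  also have "\<dots> = (\<Prod>i<n. t powr (s + 1) * t ^ i) * (\<Prod>j<n. t ^ j) * t powr (s + 1) * t ^ n * t ^ n"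
    using assms by (simp only: Suc powr_realpow)
  finally show ?case by simp
qed (use assms in simp)

lemma Dn_left_eq:
  assumes "\<alpha> > 0" "\<beta> > 0" "\<gamma> > 0" "0 < t" "t < 1"
  shows "Dn \<alpha> \<beta> \<gamma> 1 (-1) n t =
    t powr (real n * (real n + \<alpha> + \<gamma>)) * mdet n (\<lambda>i j. scaled_moment \<alpha> \<beta> \<gamma> (i + j) t)"
proof -
  have "Dn \<alpha> \<beta> \<gamma> 1 (-1) n t =
      mdet n (\<lambda>i j. (t powr (\<alpha> + \<gamma> + 1) * t ^ i) * t ^ j * scaled_moment \<alpha> \<beta> \<gamma> (i + j) t)"
    unfolding Dn_def
    by (intro mdet_cong) (simp only: integral_unique [OF has_integral_wfun_left [OF assms]], simp add: power_add)
  also have "\<dots> = (\<Prod>i<n. t powr (\<alpha> + \<gamma> + 1) * t ^ i) * (\<Prod>j<n. t ^ j) *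
      mdet n (\<lambda>i j. scaled_moment \<alpha> \<beta> \<gamma> (i + j) t)"
    by (rule mdet_scale)
  finally show ?thesis
    using prod_scaling_factors [OF \<open>0 < t\<close>, of "\<alpha> + \<gamma>" n] by (simp add: add.assoc)
qed

lemma scaled_moment_tendsto:
  assumes "\<alpha> > 0" "\<beta> > 0" "\<gamma> > 0"
  shows "(scaled_moment \<alpha> \<beta> \<gamma> m \<longlongrightarrow> Beta (\<alpha> + 1 + real m) (\<gamma> + 1)) (at_right 0)"
proof (rule tendsto_sandwich)
  have ev: "eventually (\<lambda>t::real. t \<in> {0<..<1}) (at_right 0)"
    by (rule eventually_at_right_real) simp
  have Beta: "((\<lambda>u. u ^ m * (u powr \<alpha> * (1 - u) powr \<gamma>)) has_integral Beta (\<alpha> + 1 + real m) (\<gamma> + 1)) {0..1}"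
  proof -
    have "((\<lambda>u. u powr (\<alpha> + real m) * (1 - u) powr \<gamma>) has_integral Beta (\<alpha> + 1 + real m) (\<gamma> + 1)) {0..1}"
      using has_integral_Beta_real [of "\<alpha> + 1 + real m" "\<gamma> + 1"] assms by simp
    then show ?thesis
    proof (rule has_integral_eq [rotated])
      fix u :: real
      assume "u \<in> {0..1}"
      then show "u powr (\<alpha> + real m) * (1 - u) powr \<gamma> = u ^ m * (u powr \<alpha> * (1 - u) powr \<gamma>)"
        \<comment> \<open>At u = 0 both sides vanish, since \<open>0 powr y\<close> is 0;
          \<open>powr_realpow\<close> covers u > 0.\<close>
        by (cases "u = 0") (simp_all add: powr_add powr_realpow)
    qed
  qed
  have bounds: "(1 - t) powr \<beta> * Beta (\<alpha> + 1 + real m) (\<gamma> + 1) \<le> scaled_moment \<alpha> \<beta> \<gamma> m t \<and>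
      scaled_moment \<alpha> \<beta> \<gamma> m t \<le> Beta (\<alpha> + 1 + real m) (\<gamma> + 1)" if t: "t \<in> {0<..<1}" for t
  proof
    have I: "((\<lambda>u. u ^ m * (u powr \<alpha> * (1 - t * u) powr \<beta> * (1 - u) powr \<gamma>)) has_integral scaled_moment \<alpha> \<beta> \<gamma> m t) {0..1}"
      unfolding scaled_moment_def using t assms by (intro integrable_integral scaled_moment_integrable) auto
    show "scaled_moment \<alpha> \<beta> \<gamma> m t \<le> Beta (\<alpha> + 1 + real m) (\<gamma> + 1)"
    proof (rule has_integral_le [OF I Beta])
      fix u :: real
      assume u: "u \<in> {0..1}"
      have "0 \<le> 1 - t * u" "1 - t * u \<le> 1"
        using u t by (auto intro: mult_le_one)
      then have "(1 - t * u) powr \<beta> \<le> 1"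
        using assms by (intro powr_le1) auto
      then show "u ^ m * (u powr \<alpha> * (1 - t * u) powr \<beta> * (1 - u) powr \<gamma>) \<le> u ^ m * (u powr \<alpha> * (1 - u) powr \<gamma>)"
        using u by (intro mult_left_mono mult_right_mono) (auto simp: mult_left_le)
    qed
    show "(1 - t) powr \<beta> * Beta (\<alpha> + 1 + real m) (\<gamma> + 1) \<le> scaled_moment \<alpha> \<beta> \<gamma> m t"
    proof (rule has_integral_le [OF has_integral_mult_right [OF Beta] I])
      fix u :: real
      assume u: "u \<in> {0..1}"
      have "(1 - t) powr \<beta> \<le> (1 - t * u) powr \<beta>"
        using u t assms by (intro powr_mono2) (auto simp: mult_left_le)
      then have "(1 - t) powr \<beta> * (u ^ m * (u powr \<alpha> * (1 - u) powr \<gamma>)) \<le>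
          (1 - t * u) powr \<beta> * (u ^ m * (u powr \<alpha> * (1 - u) powr \<gamma>))"
        using u by (intro mult_right_mono) auto
      then show "(1 - t) powr \<beta> * (u ^ m * (u powr \<alpha> * (1 - u) powr \<gamma>)) \<le>
          u ^ m * (u powr \<alpha> * (1 - t * u) powr \<beta> * (1 - u) powr \<gamma>)"
        by (simp add: mult_ac)
    qed
  qed
  show "eventually (\<lambda>t. (1 - t) powr \<beta> * Beta (\<alpha> + 1 + real m) (\<gamma> + 1) \<le> scaled_moment \<alpha> \<beta> \<gamma> m t) (at_right 0)"
    "eventually (\<lambda>t. scaled_moment \<alpha> \<beta> \<gamma> m t \<le> Beta (\<alpha> + 1 + real m) (\<gamma> + 1)) (at_right 0)"
    using ev bounds by (auto elim: eventually_mono)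
  have "((\<lambda>t. (1 - t) powr \<beta> * Beta (\<alpha> + 1 + real m) (\<gamma> + 1)) \<longlongrightarrow>
      (1 - 0) powr \<beta> * Beta (\<alpha> + 1 + real m) (\<gamma> + 1)) (at_right 0)"
    by (intro tendsto_intros) auto
  then show "((\<lambda>t. (1 - t) powr \<beta> * Beta (\<alpha> + 1 + real m) (\<gamma> + 1)) \<longlongrightarrow> Beta (\<alpha> + 1 + real m) (\<gamma> + 1)) (at_right 0)"
    by simp
qed simp

text \<open>The power of t cancels exactly for 0 < t < 1. The quotient left over tends to 1 because
  the limiting determinant, a product of Gamma values, is positive.\<close>

lemma Dn_left_asymp:
  assumes "\<alpha> > 0" "\<beta> > 0" "\<gamma> > 0"
  shows "((\<lambda>t. Dn \<alpha> \<beta> \<gamma> 1 (-1) n t / (barnes_const n \<alpha> \<gamma> * t powr (real n * (real n + \<alpha> + \<gamma>)))) \<longlongrightarrow> 1)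
    (at_right 0)"
proof -
  have c: "barnes_const n \<alpha> \<gamma> = mdet n (\<lambda>i j. Beta (\<alpha> + 1 + real (i + j)) (\<gamma> + 1))"
    using mdet_Beta_Hankel [of "\<alpha> + 1" "\<gamma> + 1" n] assms by (simp add: barnes_const_eq_prod add_ac)
  have pos: "barnes_const n \<alpha> \<gamma> > 0"
    using assms by (auto simp: barnes_const_eq_prod intro!: prod_pos mult_pos_pos divide_pos_pos Gamma_real_pos add_pos_nonneg)
  have "((\<lambda>t. mdet n (\<lambda>i j. scaled_moment \<alpha> \<beta> \<gamma> (i + j) t) / barnes_const n \<alpha> \<gamma>) \<longlongrightarrow>
      barnes_const n \<alpha> \<gamma> / barnes_const n \<alpha> \<gamma>) (at_right 0)"
    using pos unfolding c by (intro tendsto_divide tendsto_mdet scaled_moment_tendsto assms tendsto_const) auto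
  then have "((\<lambda>t. mdet n (\<lambda>i j. scaled_moment \<alpha> \<beta> \<gamma> (i + j) t) / barnes_const n \<alpha> \<gamma>) \<longlongrightarrow> 1) (at_right 0)"
    using pos by simp
  moreover have "eventually (\<lambda>t::real. t \<in> {0<..<1}) (at_right 0)"
    by (rule eventually_at_right_real) simp
  then have "eventually (\<lambda>t. mdet n (\<lambda>i j. scaled_moment \<alpha> \<beta> \<gamma> (i + j) t) / barnes_const n \<alpha> \<gamma> =
      Dn \<alpha> \<beta> \<gamma> 1 (-1) n t / (barnes_const n \<alpha> \<gamma> * t powr (real n * (real n + \<alpha> + \<gamma>)))) (at_right 0)"
    by eventually_elim (use assms in \<open>simp add: Dn_left_eq\<close>)
  ultimately show ?thesis by (rule Lim_transform_eventually)
qed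

section \<open>Reflection: the limit at 1 from the limit at 0\<close>

lemma wfun_reflect: "wfun \<alpha> \<beta> \<gamma> 0 1 x t = wfun \<beta> \<alpha> \<gamma> 1 (-1) (1 - x) (1 - t)"
  \<comment> \<open>At x = t the Heaviside factors are 0 and 1, but \<open>0 powr \<gamma>\<close> =
    0 makes both weights vanish.\<close>
  by (cases "x = t") (auto simp: wfun_def heaviside_def abs_minus_commute)

text \<open>With y = 1 - x the moment matrix becomes S N S^T, where S expands the powers of 1 - y in
  monomials. S is triangular with diagonal entries 1 or -1, so its determinant squares to 1.\<close>

lemma Dn_reflect:
  assumes "\<alpha> > 0" "\<beta> > 0" "\<gamma> > 0" "0 < t" "t < 1"
  shows "Dn \<alpha> \<beta> \<gamma> 0 1 n t = Dn \<beta> \<alpha> \<gamma> 1 (-1) n (1 - t)"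
proof -
  define w where "w = (\<lambda>y. wfun \<beta> \<alpha> \<gamma> 1 (-1) y (1 - t))"
  define N where "N m = integral {0..1} (\<lambda>y. y ^ m * w y)" for m
  have N: "((\<lambda>y. y ^ m * w y) has_integral N m) {0..1}" for m
    using has_integral_wfun_left [of \<beta> \<alpha> \<gamma> "1 - t" m] assms
    unfolding N_def w_def by (intro integrable_integral) (auto simp: integrable_on_def)
  define S where "S i k = (-1) ^ k * real (i choose k)" for i k
  have S: "(1 - y) ^ i = (\<Sum>k<n. S i k * y ^ k)" if "i < n" for i and y :: real
  proof -
    have "(1 - y) ^ i = (\<Sum>k\<le>i. real (i choose k) * (- y) ^ k)"
      using binomial_ring [of "- y" 1 i] by simp
    also have "\<dots> = (\<Sum>k\<le>i. S i k * y ^ k)"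
      by (simp add: S_def power_minus [of y] mult_ac)
    also have "\<dots> = (\<Sum>k<n. S i k * y ^ k)"
      using that by (intro sum.mono_neutral_left) (auto simp: S_def)
    finally show ?thesis .
  qed
  have "integral {0..1} (\<lambda>x. x ^ (i + j) * wfun \<alpha> \<beta> \<gamma> 0 1 x t) = (\<Sum>k<n. S i k * (\<Sum>l<n. N (k + l) * S j l))"
    if "i < n" "j < n" for i j
  proof (rule integral_unique)
    have "((\<lambda>y. \<Sum>k<n. S i k * (\<Sum>l<n. y ^ (k + l) * w y * S j l)) has_integral
        (\<Sum>k<n. S i k * (\<Sum>l<n. N (k + l) * S j l))) {0..1}"
      by (intro has_integral_sum has_integral_mult_right has_integral_mult_left N) auto
    moreover have "(\<Sum>k<n. S i k * (\<Sum>l<n. y ^ (k + l) * w y * S j l)) = (1 - y) ^ (i + j) * w y" for y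
    proof -
      have "(\<Sum>l<n. y ^ (k + l) * w y * S j l) = y ^ k * (w y * (1 - y) ^ j)" for k
        by (simp add: S [OF \<open>j < n\<close>] power_add sum_distrib_left mult_ac)
      then have "(\<Sum>k<n. S i k * (\<Sum>l<n. y ^ (k + l) * w y * S j l)) = (1 - y) ^ i * (w y * (1 - y) ^ j)"
        by (simp only: S [OF \<open>i < n\<close>] sum_distrib_right mult.assoc)
      then show ?thesis by (simp add: power_add mult_ac)
    qed
    ultimately have "((\<lambda>y. (1 - y) ^ (i + j) * w y) has_integral
        (\<Sum>k<n. S i k * (\<Sum>l<n. N (k + l) * S j l))) (cbox 0 1)"
      by simp
    \<comment> \<open>The substitution y = 1 - x has scaling factor 1 in absolute value and maps
      [0, 1] onto itself.\<close>
    from has_integral_affinity [OF this, of "-1" 1]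
    have "((\<lambda>x. x ^ (i + j) * w (1 - x)) has_integral
        (\<Sum>k<n. S i k * (\<Sum>l<n. N (k + l) * S j l))) ((\<lambda>x. 1 - x) ` {0..1})"
      by simp
    also have "(\<lambda>x. 1 - x) ` {0..1::real} = {0..1}"
      by simp
    finally show "((\<lambda>x. x ^ (i + j) * wfun \<alpha> \<beta> \<gamma> 0 1 x t) has_integral
        (\<Sum>k<n. S i k * (\<Sum>l<n. N (k + l) * S j l))) {0..1}"
      by (simp add: w_def wfun_reflect)
  qed
  then have "Dn \<alpha> \<beta> \<gamma> 0 1 n t = mdet n (\<lambda>i j. \<Sum>k<n. S i k * (\<Sum>l<n. N (k + l) * S j l))"
    unfolding Dn_def by (intro mdet_cong) auto
  also have "\<dots> = mdet n S * (mdet n (\<lambda>k l. N (k + l)) * mdet n (\<lambda>l j. S j l))"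
    by (simp only: mdet_mult)
  also have "\<dots> = (mdet n S)\<^sup>2 * mdet n (\<lambda>k l. N (k + l))"
    by (simp only: mdet_transpose [of n S] power2_eq_square mult_ac)
  also have "mdet n S = (\<Prod>i<n. (-1) ^ i)"
    by (subst mdet_lower_triangular) (auto simp: S_def)
  also have "(\<Prod>i<n. (-1) ^ i)\<^sup>2 = (1::real)"
    by (simp add: prod_power_distrib power_mult [symmetric] mult.commute)
  finally show ?thesis by (simp add: Dn_def N_def w_def)
qed

lemma Dn_right_asymp:
  assumes "\<alpha> > 0" "\<beta> > 0" "\<gamma> > 0"
  shows "((\<lambda>t. Dn \<alpha> \<beta> \<gamma> 0 1 n t / (barnes_const n \<beta> \<gamma> * (1 - t) powr (real n * (real n + \<beta> + \<gamma>)))) \<longlongrightarrow> 1)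
    (at_left 1)"
proof -
  have "filterlim (\<lambda>t. 1 - t) (at_right (0::real)) (at_left 1)"
    by real_asymp
  \<comment> \<open>The reflection exchanges the exponents at 0 and 1, hence the first two
    hypotheses are swapped.\<close>
  from filterlim_compose [OF Dn_left_asymp [OF assms(2,1,3)] this]
  have "((\<lambda>t. Dn \<beta> \<alpha> \<gamma> 1 (-1) n (1 - t) / (barnes_const n \<beta> \<gamma> * (1 - t) powr (real n * (real n + \<beta> + \<gamma>)))) \<longlongrightarrow> 1)
    (at_left 1)" .
  moreover have "eventually (\<lambda>t::real. t \<in> {0<..<1}) (at_left 1)"
    by (rule eventually_at_left_real) simp
  then have "eventually (\<lambda>t. Dn \<beta> \<alpha> \<gamma> 1 (-1) n (1 - t) / (barnes_const n \<beta> \<gamma> * (1 - t) powr (real n * (real n + \<beta> + \<gamma>))) =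
      Dn \<alpha> \<beta> \<gamma> 0 1 n t / (barnes_const n \<beta> \<gamma> * (1 - t) powr (real n * (real n + \<beta> + \<gamma>)))) (at_left 1)"
    by eventually_elim (use assms in \<open>simp add: Dn_reflect\<close>)
  ultimately show ?thesis by (rule Lim_transform_eventually)
qed

theorem theorem4p2:
  fixes \<alpha> \<beta> \<gamma> :: real and n :: nat
  assumes "\<alpha> > 0" "\<beta> > 0" "\<gamma> > 0" "n \<ge> 1"
  shows "((\<lambda>t. Dn \<alpha> \<beta> \<gamma> 0 1 n t /
            (2 powr (- 2 * real n * (real n + \<beta> + \<gamma>)) * (2 * pi) ^ n
             * (Gamma ((\<beta> + \<gamma> + 1) / 2) * (barnesG ((\<beta> + \<gamma> + 1) / 2))^2
                * (barnesG ((\<beta> + \<gamma>) / 2 + 1))^2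
                / (barnesG (\<beta> + \<gamma> + 1) * barnesG (\<beta> + 1) * barnesG (\<gamma> + 1)))
             * (barnesG (real n + 1) * barnesG (real n + \<beta> + 1) * barnesG (real n + \<gamma> + 1)
                * barnesG (real n + \<beta> + \<gamma> + 1)
                / ((barnesG (real n + (\<beta> + \<gamma> + 1) / 2))^2 * (barnesG (real n + (\<beta> + \<gamma>) / 2 + 1))^2
                   * Gamma (real n + (\<beta> + \<gamma> + 1) / 2)))
             * (1 - t) powr (real n * (real n + \<beta> + \<gamma>))))
          \<longlongrightarrow> 1) (at_left 1)
       \<and>
         ((\<lambda>t. Dn \<alpha> \<beta> \<gamma> 1 (-1) n t /
            (2 powr (- 2 * real n * (real n + \<alpha> + \<gamma>)) * (2 * pi) ^ n
             * (Gamma ((\<alpha> + \<gamma> + 1) / 2) * (barnesG ((\<alpha> + \<gamma> + 1) / 2))^2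
                * (barnesG ((\<alpha> + \<gamma>) / 2 + 1))^2
                / (barnesG (\<alpha> + \<gamma> + 1) * barnesG (\<alpha> + 1) * barnesG (\<gamma> + 1)))
             * (barnesG (real n + 1) * barnesG (real n + \<alpha> + 1) * barnesG (real n + \<gamma> + 1)
                * barnesG (real n + \<alpha> + \<gamma> + 1)
                / ((barnesG (real n + (\<alpha> + \<gamma> + 1) / 2))^2 * (barnesG (real n + (\<alpha> + \<gamma>) / 2 + 1))^2
                   * Gamma (real n + (\<alpha> + \<gamma> + 1) / 2)))
             * t powr (real n * (real n + \<alpha> + \<gamma>))))
          \<longlongrightarrow> 1) (at_right 0)"
  using Dn_right_asymp [OF assms(1-3), of n] Dn_left_asymp [OF assms(1-3), of n]
  unfolding barnes_const_def by (rule conjI)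

end
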